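(* For every integer $k\ge2$, $z_{f_1}^k=\max\{\sqrt{M_1/m_1},\,M_2/m_2\}$.
   Context: Fix reals $0<m_i\le M_i$, $i=1,\dots,k$, indexed so that $M_1/m_1\ge M_2/m_2\ge\cdots\ge M_k/m_k$ (standing assumption of the paper). Let $f_1(c_1,\dots,c_k)=\max(c_1,\dots,c_k)$. Let $\mathcal{S}_{f_1}^k=\{(x_1,\dots,x_k)\in[m_1,M_1]\times\cdots\times[m_k,M_k]: \max(M_1/x_1,\dots,M_k/x_k)=\max(x_1/m_1,\dots,x_k/m_k)\}$ and $z_{f_1}^k=\sup_{(x_1,\dots,x_k)\in\mathcal{S}_{f_1}^k}\max(M_1/x_1,\dots,M_k/x_k)$. *)

theory Defs
  imports Complex_Main "HOL-Library.FuncSet"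
begin

text \<open>A \<open>k\<close>-tuple is a function on the index set \<open>{1..k}\<close>; its values elsewhere are irrelevant.\<close>

definition f\<^sub>1 :: "nat \<Rightarrow> (nat \<Rightarrow> real) \<Rightarrow> real" where
  "f\<^sub>1 k c = Max (c ` {1..k})"

text \<open>The set and the supremum are stated for an arbitrary \<open>f\<close>, which takes the number of
  arguments \<open>k\<close> and the tuple of arguments.\<close>

definition S_set ::
  "(nat \<Rightarrow> (nat \<Rightarrow> real) \<Rightarrow> real) \<Rightarrow> nat \<Rightarrow> (nat \<Rightarrow> real) \<Rightarrow> (nat \<Rightarrow> real) \<Rightarrow> (nat \<Rightarrow> real) set" where
  "S_set f k m M =
     {x \<in> (\<Pi>\<^sub>E i\<in>{1..k}. {m i..M i}). f k (\<lambda>i. M i / x i) = f k (\<lambda>i. x i / m i)}"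

definition z_sup ::
  "(nat \<Rightarrow> (nat \<Rightarrow> real) \<Rightarrow> real) \<Rightarrow> nat \<Rightarrow> (nat \<Rightarrow> real) \<Rightarrow> (nat \<Rightarrow> real) \<Rightarrow> real" where
  "z_sup f k m M = (SUP x\<in>S_set f k m M. f k (\<lambda>i. M i / x i))"

end

theory Submission
  imports Defs
begin

text \<open>Write \<open>r i = M i / m i\<close>. At a point of the set, the common value \<open>z\<close> of the two maxima is
  \<open>M i / x i\<close> for some \<open>i\<close> and \<open>x j / m j\<close> for some \<open>j\<close>. If \<open>i = j\<close>, then \<open>z\<^sup>2 = r i \<le> r 1\<close>;
  otherwise \<open>z \<le> r i\<close> and \<open>z \<le> r j\<close>, and one of the two indices is at least \<open>2\<close>, so \<open>z \<le> r 2\<close>.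
  The bound is attained: by the geometric means \<open>x i = sqrt (m i * M i)\<close> if \<open>r 2 \<le> sqrt (r 1)\<close>, and
  otherwise by the same point with \<open>x 1\<close> replaced by \<open>m 1 * r 2\<close> and \<open>x 2\<close> by \<open>m 2\<close>.\<close>

lemma f\<^sub>1_eqI:
  assumes "j \<in> {1..k}" "c j = z" "\<And>i. i \<in> {1..k} \<Longrightarrow> c i \<le> z"
  shows "f\<^sub>1 k c = z"
  unfolding f\<^sub>1_def using assms by (intro Max_eqI) auto

lemma f\<^sub>1_attained:
  assumes "1 \<le> k"
  obtains i where "i \<in> {1..k}" "f\<^sub>1 k c = c i"
proof -
  have "f\<^sub>1 k c \<in> c ` {1..k}"
    unfolding f\<^sub>1_def using assms by (intro Max_in) auto
  then show thesis using that by blast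
qed

text \<open>The geometric mean is the point where the two ratios \<open>b / x\<close> and
  \<open>x / a\<close> agree. Substituting squares for \<open>a\<close> and \<open>b\<close> removes
  the roots, leaving cancellation.\<close>

lemma sqrt_mult_between:
  fixes a b :: real
  assumes "0 < a" "a \<le> b"
  shows "sqrt (a * b) \<in> {a..b}"
    and "b / sqrt (a * b) = sqrt (b / a)" and "sqrt (a * b) / a = sqrt (b / a)"
proof -
  define s t where "s = sqrt a" and "t = sqrt b"
  have st: "0 < s" "s \<le> t" "0 < t" and a: "a = s * s" and b: "b = t * t"
    using assms by (auto simp: s_def t_def)
  have ab: "sqrt (a * b) = s * t" and ba: "sqrt (b / a) = t / s"
    by (simp_all add: s_def t_def real_sqrt_mult real_sqrt_divide)
  show "sqrt (a * b) \<in> {a..b}"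
    unfolding ab unfolding a b using st by (simp add: mult_left_mono mult_right_mono)
  show "b / sqrt (a * b) = sqrt (b / a)" "sqrt (a * b) / a = sqrt (b / a)"
    unfolding ab ba unfolding a b using st by simp_all
qed

theorem theorem4:
  fixes k :: nat and m M :: "nat \<Rightarrow> real"
  assumes "k \<ge> 2"
    and "\<And>i. i \<in> {1..k} \<Longrightarrow> 0 < m i \<and> m i \<le> M i"
    and "\<And>i j. 1 \<le> i \<Longrightarrow> i \<le> j \<Longrightarrow> j \<le> k \<Longrightarrow> M j / m j \<le> M i / m i"
  shows "z_sup f\<^sub>1 k m M = max (sqrt (M 1 / m 1)) (M 2 / m 2)"
proof -
  define r where "r i = M i / m i" for i
  define g where "g i = sqrt (m i * M i)" for i
  let ?z = "max (sqrt (r 1)) (r 2)"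
  have pos: "0 < m i" "m i \<le> M i" "0 < M i" "1 \<le> r i" if "i \<in> {1..k}" for i
    using assms(2)[OF that] by (auto simp: r_def)
  have r1: "r i \<le> r 1" if "i \<in> {1..k}" for i
    using assms(3)[of 1 i] that by (auto simp: r_def)
  have r2: "r i \<le> r 2" if "i \<in> {1..k}" "i \<noteq> 1" for i
    using assms(3)[of 2 i] that by (auto simp: r_def)
  have k12: "1 \<in> {1..k}" "2 \<in> {1..k}" using assms(1) by auto
  have g: "g i \<in> {m i..M i}" "M i / g i = sqrt (r i)" "g i / m i = sqrt (r i)"
    if "i \<in> {1..k}" for i
    using sqrt_mult_between[of "m i" "M i"] pos[OF that] by (auto simp: g_def r_def)
  have upper: "f\<^sub>1 k (\<lambda>i. M i / x i) \<le> ?z" if x: "x \<in> S_set f\<^sub>1 k m M" for x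
  proof -
    define z where "z = f\<^sub>1 k (\<lambda>i. M i / x i)"
    have z': "z = f\<^sub>1 k (\<lambda>i. x i / m i)" using x by (simp add: S_set_def z_def)
    have x_in: "m i \<le> x i" "x i \<le> M i" if "i \<in> {1..k}" for i
      using x that by (auto simp: S_set_def PiE_iff)
    obtain i where i: "i \<in> {1..k}" "z = M i / x i"
      using f\<^sub>1_attained[of k "\<lambda>i. M i / x i"] k12 unfolding z_def by auto
    obtain j where j: "j \<in> {1..k}" "z = x j / m j"
      using f\<^sub>1_attained[of k "\<lambda>i. x i / m i"] k12 unfolding z' by auto
    have "z \<le> ?z"
    proof (cases "i = j")
      case True
      have "z\<^sup>2 = (M i / x i) * (x i / m i)"
        using i(2) j(2) True by (simp add: power2_eq_square)
      also have "\<dots> = r i" using x_in[OF i(1)] pos[OF i(1)] by (simp add: r_def)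
      finally have "z \<le> sqrt (r 1)" using r1[OF i(1)] by (intro real_le_rsqrt) simp
      then show ?thesis by simp
    next
      case False
      have "z \<le> r i" unfolding i(2) r_def using pos[OF i(1)] x_in[OF i(1)]
        by (intro divide_left_mono) auto
      moreover have "z \<le> r j" unfolding j(2) r_def using pos[OF j(1)] x_in[OF j(1)]
        by (intro divide_right_mono) auto
      ultimately have "z \<le> r 2" using False r2[OF i(1)] r2[OF j(1)] by fastforce
      then show ?thesis by simp
    qed
    then show ?thesis by (simp add: z_def)
  qed
  have attained: "?z \<in> (\<lambda>x. f\<^sub>1 k (\<lambda>i. M i / x i)) ` S_set f\<^sub>1 k m M"
  proof -
    \<comment> \<open>Both cases below only supply a point \<open>y\<close> and indices
      \<open>a\<close>, \<open>b\<close> at which the two maxima are attained. Restricting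
      \<open>y\<close> to \<open>{1..k}\<close> puts it in the extensional product without changing
      either maximum.\<close>
    have witness: ?thesis
      if "\<And>i. i \<in> {1..k} \<Longrightarrow> y i \<in> {m i..M i}"
        and "a \<in> {1..k}" "M a / y a = ?z" and "b \<in> {1..k}" "y b / m b = ?z"
        and "\<And>i. i \<in> {1..k} \<Longrightarrow> M i / y i \<le> ?z \<and> y i / m i \<le> ?z" for y a b
    proof -
      let ?x = "restrict y {1..k}"
      have "f\<^sub>1 k (\<lambda>i. M i / ?x i) = ?z" using that by (intro f\<^sub>1_eqI[of a]) auto
      moreover have "f\<^sub>1 k (\<lambda>i. ?x i / m i) = ?z" using that by (intro f\<^sub>1_eqI[of b]) auto
      ultimately have "?x \<in> S_set f\<^sub>1 k m M" using that(1)
        unfolding S_set_def by (simp add: restrict_PiE_iff)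
      then show ?thesis using \<open>f\<^sub>1 k (\<lambda>i. M i / ?x i) = ?z\<close>
        by (intro image_eqI[where x = ?x]) simp_all
    qed
    have sqrt_le: "sqrt (r i) \<le> sqrt (r 1)" if "i \<in> {1..k}" for i
      using r1[OF that] by simp
    show ?thesis
    proof (cases "r 2 \<le> sqrt (r 1)")
      case True
      then have z: "?z = sqrt (r 1)" by simp
      show ?thesis
        \<comment> \<open>At \<open>g\<close> both ratios of index \<open>i\<close> equal
          \<open>sqrt (r i)\<close>, so index 1 carries both maxima.\<close>
        by (rule witness[of g 1 1], unfold z) (use g k12 sqrt_le in auto)
    next
      case False
      then have z: "?z = r 2" by simp
      \<comment> \<open>The two maxima now sit at different indices: the left endpoint
        \<open>m 2\<close> gives \<open>M 2 / y 2 = r 2\<close>, and \<open>y 1\<close> is chosen to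
        make \<open>y 1 / m 1 = r 2\<close>.\<close>
      define y where "y = g(1 := m 1 * r 2, 2 := m 2)"
      have y1: "y 1 = m 1 * r 2" and y2: "y 2 = m 2" by (simp_all add: y_def)
      have y: "y i = g i" if "i \<noteq> 1" "i \<noteq> 2" for i using that by (simp add: y_def)
      note p1 = pos[OF k12(1)] and p2 = pos[OF k12(2)]
      have M1: "M 1 = m 1 * r 1" using p1 by (simp add: r_def)
      \<comment> \<open>The other ratio at index 1 is \<open>M 1 / y 1 = r 1 / r 2\<close>; it stays
        below \<open>r 2\<close> exactly when \<open>r 1\<close> is at most the square of
        \<open>r 2\<close>.\<close>
      have "r 1 = (sqrt (r 1))\<^sup>2" using p1 by simp
      also have "\<dots> \<le> (r 2)\<^sup>2" using False p1 by (intro power_mono) auto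
      finally have sq: "r 1 \<le> r 2 * r 2" by (simp add: power2_eq_square)
      \<comment> \<open>Membership amounts to \<open>1 \<le> r 2\<close> and
        \<open>r 2 \<le> r 1\<close>.\<close>
      have b1: "y 1 \<in> {m 1..M 1}"
        using p1 p2 r1[OF k12(2)] unfolding y1 M1 by auto
      have c1: "M 1 / y 1 \<le> r 2" "y 1 / m 1 = r 2"
        using sq p1 p2 unfolding y1 M1 by (auto simp: field_simps)
      have b2: "y 2 \<in> {m 2..M 2}" and c2: "M 2 / y 2 = r 2" "y 2 / m 2 \<le> r 2"
        using p2 by (auto simp: y2 r_def)
      have "y i \<in> {m i..M i} \<and> M i / y i \<le> r 2 \<and> y i / m i \<le> r 2" if i: "i \<in> {1..k}" for i
      proof -
        consider "i = 1" | "i = 2" | "i \<noteq> 1" "i \<noteq> 2" by blast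
        then show ?thesis
        proof cases
          case 3
          have "sqrt (r i) \<le> r 2" using sqrt_le[OF i] False by linarith
          with 3 show ?thesis using g[OF i] y[of i] by simp
        qed (use b1 b2 c1 c2 in auto)
      qed
      then show ?thesis
        by (intro witness[of y 2 1], unfold z) (use k12 c1 c2 in auto)
    qed
  qed
  \<comment> \<open>The supremum is a maximum, so \<open>attained\<close> and \<open>upper\<close>
    also settle nonemptiness and boundedness.\<close>
  have "z_sup f\<^sub>1 k m M = ?z"
    unfolding z_sup_def using attained upper by (intro cSup_eq_maximum) auto
  then show ?thesis by (simp add: r_def)
qed

end
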